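(* Let $n\geq 2$ and let $C=\alpha I+\beta\Pi$ be of order $n$ with $\alpha,\beta\in\mathbb{C}\setminus\{0\}$. Then $C$ is singular if and only if $\beta^{n}=(-1)^{n}\alpha^{n}$, and the following assertions hold: (i) If $n$ is even and $\alpha=\beta$, then $\mathrm{N}(C)=\mathrm{span}\{(1,-1,1,-1,\ldots,1,-1)\}$ and $$C^{\dagger}=\frac{1}{\alpha n^{2}}\left(\frac{1}{2}\mathrm{circ}(w)-\mathrm{circ}(1,-1,1,-1,\ldots,1,-1)\right),$$ where $w\in\mathbb{R}^n$ is given by $w(k)=(-1)^{k+1}\left(n^{2}-(2k-1)n+2\right)$ for $k=1,\ldots,n$. (ii) If $\alpha=-\beta$, then $\mathrm{N}(C)=\mathrm{span}\{(1,1,\ldots,1)\}$ and $$C^{\dagger}=\frac{1}{2\alpha}\left(-\frac{1}{n}\mathrm{circ}(1,3,5,\ldots,2n-1)+ee^{t}\right)=\frac{1}{2n\alpha}\mathrm{circ}(n-1,n-3,n-5,\ldots,3-n,1-n),$$ where the $k$th entry of the last generating vector is $n+1-2k$, $k=1,\ldots,n$.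
   Context: For $c\in\mathbb{C}^n$, $\mathrm{circ}(c)$ is the $n\times n$ circulant matrix whose first row is $(c(1),\ldots,c(n))$ and each of whose subsequent rows is the cyclic right shift by one of the previous row. $\Pi=\mathrm{circ}(0,1,0,\ldots,0)$, so $\mathrm{circ}(c)=\sum_{k=0}^{n-1}c(k+1)\Pi^k$. Vectors are regarded as column vectors; $e$ is the vector in $\mathbb{C}^n$ with all components equal to $1$; $t$ denotes transpose; $\mathrm{N}(C)$ is the null space. $C^{\dagger}$ is the Moore--Penrose inverse: the unique matrix $X$ with $CXC=C$, $XCX=X$, $(CX)^{*}=CX$, $(XC)^{*}=XC$. *)

theory Defs
  imports Complex_Main "Jordan_Normal_Form.Matrix_Kernel" "Jordan_Normal_Form.Schur_Decomposition"
begin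

text \<open>Vectors and matrices of the library are indexed from 0, so position \<open>i\<close> below holds
  the component that is numbered \<open>i + 1\<close> in the usual notation.\<close>

definition vec1 :: "nat \<Rightarrow> (nat \<Rightarrow> 'a) \<Rightarrow> 'a vec" where
  "vec1 n f = vec n (\<lambda>i. f (i + 1))"

definition cyclic_right_shift :: "'a vec \<Rightarrow> 'a vec" where
  "cyclic_right_shift v = vec (dim_vec v) (\<lambda>j. v $ (if j = 0 then dim_vec v - 1 else j - 1))"

definition circ :: "'a vec \<Rightarrow> 'a mat" where
  "circ c = mat_of_rows (dim_vec c) (map (\<lambda>i. (cyclic_right_shift ^^ i) c) [0..<dim_vec c])"

lemma dim_cyclic_right_shift [simp]: "dim_vec (cyclic_right_shift v) = dim_vec v"
  by (simp add: cyclic_right_shift_def)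

lemma cyclic_right_shift_index:
  "j < dim_vec v \<Longrightarrow>
    cyclic_right_shift v $ j = v $ (if j = 0 then dim_vec v - 1 else j - 1)"
  by (simp add: cyclic_right_shift_def)

lemma dim_cyclic_right_shift_funpow [simp]: "dim_vec ((cyclic_right_shift ^^ i) v) = dim_vec v"
  by (induction i) simp_all

lemma circ_carrier: "circ c \<in> carrier_mat (dim_vec c) (dim_vec c)"
  unfolding circ_def by (rule carrier_matI) simp_all

lemma cyclic_right_shift_funpow_index:
  assumes "j < dim_vec c" "i < dim_vec c"
  shows "(cyclic_right_shift ^^ i) c $ j = c $ (if i \<le> j then j - i else j + dim_vec c - i)"
  using assms
proof (induction i arbitrary: j)
  case (Suc i)
  let ?j = "if j = 0 then dim_vec c - 1 else j - 1"
  have "(cyclic_right_shift ^^ Suc i) c $ j = (cyclic_right_shift ^^ i) c $ ?j"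
    using Suc.prems by (simp add: cyclic_right_shift_index)
  also have "\<dots> = c $ (if i \<le> ?j then ?j - i else ?j + dim_vec c - i)"
    using Suc.prems by (intro Suc.IH) auto
  also have "(if i \<le> ?j then ?j - i else ?j + dim_vec c - i)
      = (if Suc i \<le> j then j - Suc i else j + dim_vec c - Suc i)"
    using Suc.prems by auto
  finally show ?case .
qed simp

lemma circ_index:
  assumes "i < dim_vec c" "j < dim_vec c"
  shows "circ c $$ (i, j) = c $ ((j + dim_vec c - i) mod dim_vec c)"
proof -
  have "(if i \<le> j then j - i else j + dim_vec c - i) = (j + dim_vec c - i) mod dim_vec c"
  proof (cases "i \<le> j")
    case True
    then have "j + dim_vec c - i = (j - i) + dim_vec c" and lt: "j - i < dim_vec c"
      using assms by auto
    then have "(j + dim_vec c - i) mod dim_vec c = (j - i) mod dim_vec c"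
      by (metis mod_add_self2)
    also have "\<dots> = j - i" using lt by (rule mod_less)
    finally show ?thesis using True by (simp only: if_True)
  next
    case False
    then have "j + dim_vec c - i < dim_vec c" using assms by auto
    then show ?thesis using False by simp
  qed
  then show ?thesis
    using assms by (simp add: circ_def mat_of_rows_index cyclic_right_shift_funpow_index)
qed

definition Pi_mat :: "nat \<Rightarrow> 'a :: zero_neq_one mat" where
  "Pi_mat n = circ (unit_vec n 1)"

definition ones_vec :: "nat \<Rightarrow> 'a :: one vec" where
  "ones_vec n = vec n (\<lambda>_. 1)"

definition col_mat :: "'a vec \<Rightarrow> 'a mat" where
  "col_mat v = mat_of_cols (dim_vec v) [v]"

abbreviation vec_span :: "nat \<Rightarrow> 'a :: field vec set \<Rightarrow> 'a vec set" where
  "vec_span n \<equiv> LinearCombinations.module.span class_ring (module_vec TYPE('a) n)"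

definition is_moore_penrose :: "complex mat \<Rightarrow> complex mat \<Rightarrow> bool" where
  "is_moore_penrose C X \<longleftrightarrow>
     X \<in> carrier_mat (dim_col C) (dim_row C) \<and>
     C * X * C = C \<and> X * C * X = X \<and>
     mat_adjoint (C * X) = C * X \<and> mat_adjoint (X * C) = X * C"

definition moore_penrose :: "complex mat \<Rightarrow> complex mat" where
  "moore_penrose C = (THE X. is_moore_penrose C X)"

lemma mat_adjoint_dim [simp]:
  "dim_row (mat_adjoint A) = dim_col A" "dim_col (mat_adjoint A) = dim_row A"
  by (simp_all add: mat_adjoint_def)

lemma mat_adjoint_index:
  fixes A :: "complex mat"
  assumes "i < dim_col A" "j < dim_row A"
  shows "mat_adjoint A $$ (i, j) = cnj (A $$ (j, i))"
  using assms by (simp add: mat_adjoint_def mat_of_rows_index)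

lemma mat_mult_index_sum:
  fixes A B :: "complex mat"
  assumes "i < dim_row A" "j < dim_col B" "dim_col A = dim_row B"
  shows "(A * B) $$ (i, j) = (\<Sum>k<dim_row B. A $$ (i, k) * B $$ (k, j))"
  using assms by (simp add: scalar_prod_def atLeast0LessThan)

lemma mat_adjoint_mult:
  fixes A B :: "complex mat"
  assumes "A \<in> carrier_mat n m" "B \<in> carrier_mat m k"
  shows "mat_adjoint (A * B) = mat_adjoint B * mat_adjoint A"
proof (rule eq_matI)
  fix i j
  assume "i < dim_row (mat_adjoint B * mat_adjoint A)" "j < dim_col (mat_adjoint B * mat_adjoint A)"
  then have i: "i < dim_col B" and j: "j < dim_row A" by simp_all
  have d: "dim_col A = m" "dim_row B = m" using assms by auto
  have "mat_adjoint (A * B) $$ (i, j) = cnj ((A * B) $$ (j, i))"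
    using i j by (intro mat_adjoint_index) simp_all
  also have "\<dots> = (\<Sum>l<m. cnj (A $$ (j, l)) * cnj (B $$ (l, i)))"
    using mat_mult_index_sum[of j A i B] i j d by simp
  also have "\<dots> = (\<Sum>l<m. mat_adjoint B $$ (i, l) * mat_adjoint A $$ (l, j))"
  proof (rule sum.cong[OF refl])
    fix l assume "l \<in> {..<m}"
    then show "cnj (A $$ (j, l)) * cnj (B $$ (l, i)) = mat_adjoint B $$ (i, l) * mat_adjoint A $$ (l, j)"
      using mat_adjoint_index[of i B l] mat_adjoint_index[of l A j] i j d by simp
  qed
  also have "\<dots> = (mat_adjoint B * mat_adjoint A) $$ (i, j)"
    using mat_mult_index_sum[of i "mat_adjoint B" j "mat_adjoint A"] i j d by simp
  finally show "mat_adjoint (A * B) $$ (i, j) = (mat_adjoint B * mat_adjoint A) $$ (i, j)" .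
qed simp_all

text \<open>The description in \<open>moore_penrose\<close> has at most one witness.\<close>

lemma is_moore_penrose_unique:
  assumes X: "is_moore_penrose C X" and Y: "is_moore_penrose C Y"
  shows "X = Y"
proof -
  note ax = X[unfolded is_moore_penrose_def] and ay = Y[unfolded is_moore_penrose_def]
  have x: "C * X * C = C" "X * C * X = X" "mat_adjoint (C * X) = C * X" "mat_adjoint (X * C) = X * C"
    using ax by blast+
  have y: "C * Y * C = C" "Y * C * Y = Y" "mat_adjoint (C * Y) = C * Y" "mat_adjoint (Y * C) = Y * C"
    using ay by blast+
  have C: "C \<in> carrier_mat (dim_row C) (dim_col C)" by (rule carrier_matI[OF refl refl])
  have cX: "X \<in> carrier_mat (dim_col C) (dim_row C)" and cY: "Y \<in> carrier_mat (dim_col C) (dim_row C)"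
    using ax ay by blast+
  note CX = mult_carrier_mat[OF C cX] and CY = mult_carrier_mat[OF C cY]
    and XC = mult_carrier_mat[OF cX C] and YC = mult_carrier_mat[OF cY C]
  have 1: "C * X = C * Y"
  proof -
    have "C * X = (C * Y * C) * X" by (simp only: y)
    also have "\<dots> = (C * Y) * (C * X)" by (rule assoc_mult_mat[OF CY C cX])
    also have "\<dots> = mat_adjoint (C * Y) * mat_adjoint (C * X)" by (simp only: x y)
    also have "\<dots> = mat_adjoint ((C * X) * (C * Y))" by (rule mat_adjoint_mult[OF CX CY, symmetric])
    also have "(C * X) * (C * Y) = (C * X * C) * Y" by (rule assoc_mult_mat[OF CX C cY, symmetric])
    also have "mat_adjoint \<dots> = C * Y" by (simp only: x y)
    finally show ?thesis .
  qed
  have 2: "X * C = Y * C"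
  proof -
    have "X * C = X * (C * Y * C)" by (simp only: y)
    also have "\<dots> = X * (C * (Y * C))" by (simp only: assoc_mult_mat[OF C cY C])
    also have "\<dots> = (X * C) * (Y * C)" by (rule assoc_mult_mat[OF cX C YC, symmetric])
    also have "\<dots> = mat_adjoint (X * C) * mat_adjoint (Y * C)" by (simp only: x y)
    also have "\<dots> = mat_adjoint ((Y * C) * (X * C))" by (rule mat_adjoint_mult[OF YC XC, symmetric])
    also have "(Y * C) * (X * C) = Y * (C * (X * C))" by (rule assoc_mult_mat[OF cY C XC])
    also have "\<dots> = Y * (C * X * C)" by (simp only: assoc_mult_mat[OF C cX C])
    also have "mat_adjoint \<dots> = Y * C" by (simp only: x y)
    finally show ?thesis .
  qed
  have "X = Y * C * X" using x(2) unfolding 2 by (rule sym)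
  also have "\<dots> = Y * (C * X)" by (rule assoc_mult_mat[OF cY C cX])
  also have "\<dots> = Y * (C * Y)" by (simp only: 1)
  also have "\<dots> = Y * C * Y" by (rule assoc_mult_mat[OF cY C cY, symmetric])
  also have "\<dots> = Y" by (rule y(2))
  finally show ?thesis .
qed

lemma moore_penrose_eqI: "is_moore_penrose C X \<Longrightarrow> moore_penrose C = X"
  unfolding moore_penrose_def by (rule the_equality, assumption, rule is_moore_penrose_unique)

end

theory Submission
  imports Defs
begin

text \<open>The equation C u = 0 is a cyclic first-order recurrence with ratio r =
  -\<alpha>/\<beta>: the rows other than the last force u to be a multiple of the geometric vector
  (r^i), and the last row, which wraps around, adds u(0) r^n = u(0)
  (\<open>circ_bidiag_mult_vec_eq_0_iff\<close>). A nonzero null vector thus exists iff r^n = 1,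
  that is \<beta>^n = (-1)^n \<alpha>^n, and then the kernel is the line through (r^i).

  Parts (i) and (ii) are r = s with s = -1 and s = 1. Multiplying a circulant by C takes a twisted
  cyclic difference of its first row. A centred arithmetic progression twisted by s^d has constant
  differences up to that twist, except at the wrap-around, so the circulant X that it generates
  satisfies C X = X C = I - v v^t / n with v = (s^i). This is the orthogonal projection along the
  kernel of C, and X v = 0 by centring, so the Penrose equations hold
  (\<open>is_moore_penrose_circ_bidiag\<close>). Uniqueness identifies X with the Moore-Penrose
  inverse; the stated closed forms agree with X entry by entry.\<close>

section \<open>Spans of one vector, invertibility by determinants\<close>

lemma vec_span_singleton:
  fixes v :: "'a :: field vec"
  assumes "v \<in> carrier_vec n"
  shows "vec_span n {v} = {a \<cdot>\<^sub>v v | a. True}"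
proof -
  interpret vec_space "TYPE('a)" n .
  have "lincomb a {v} = a v \<cdot>\<^sub>v v" for a
    using assms by (simp add: lincomb_def)
  then show ?thesis
    using assms by (subst finite_span) (auto intro: exI[of _ "\<lambda>_. _"])
qed

lemma invertible_mat_iff_det:
  fixes A :: "'a :: field mat"
  assumes A: "A \<in> carrier_mat n n"
  shows "invertible_mat A \<longleftrightarrow> det A \<noteq> 0"
proof
  assume "invertible_mat A"
  then obtain B where AB: "A * B = 1\<^sub>m n" and BA: "B * A = 1\<^sub>m (dim_row B)"
    using A unfolding invertible_mat_def inverts_mat_def by auto
  \<comment> \<open>\<open>inverts_mat\<close> does not fix the shape of the inverse; comparing
    column counts in the two products does.\<close>
  have "B \<in> carrier_mat n n"
    using arg_cong[OF AB, of dim_col] arg_cong[OF BA, of dim_col] A by auto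
  then have "det A * det B = 1"
    using det_mult[OF A] AB by (metis det_one)
  then show "det A \<noteq> 0" by auto
next
  assume "det A \<noteq> 0"
  from det_non_zero_imp_unit[OF A this, of "()"] obtain B
    where "B \<in> carrier_mat n n" "A * B = 1\<^sub>m n" "B * A = 1\<^sub>m n"
    unfolding Units_def ring_mat_def by auto
  then show "invertible_mat A"
    using A unfolding invertible_mat_def inverts_mat_def by auto
qed

section \<open>Entries and products of circulants\<close>

text \<open>A form of \<open>circ_index\<close> without \<open>mod\<close>, so that later
  comparisons of offsets are case splits in linear arithmetic.\<close>

lemma circ_index_diff:
  assumes "i < dim_vec c" "j < dim_vec c"
  shows "circ c $$ (i, j) = c $ (if i \<le> j then j - i else j + dim_vec c - i)"
  using assms by (simp add: circ_def mat_of_rows_index cyclic_right_shift_funpow_index)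

lemma dim_circ [simp]: "dim_row (circ c) = dim_vec c" "dim_col (circ c) = dim_vec c"
  using circ_carrier[of c] by auto

lemma Pi_mat_carrier [simp]: "Pi_mat n \<in> carrier_mat n n"
  using circ_carrier[of "unit_vec n 1"] by (simp add: Pi_mat_def)

lemma dim_Pi_mat [simp]: "dim_row (Pi_mat n) = n" "dim_col (Pi_mat n) = n"
  by (simp_all add: Pi_mat_def)

text \<open>The bound on n matters: \<open>unit_vec 1 1\<close> is the zero vector, so
  \<open>Pi_mat 1\<close> would be zero instead of a permutation matrix.\<close>

lemma Pi_mat_index:
  assumes "n \<ge> 2" "i < n" "j < n"
  shows "Pi_mat n $$ (i, j) = (if j = (if Suc i = n then 0 else Suc i) then 1 else 0)"
  using assms by (cases "Suc i = n"; cases "i \<le> j") (simp_all add: Pi_mat_def circ_index_diff, auto)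

definition circ_bidiag :: "nat \<Rightarrow> complex \<Rightarrow> complex \<Rightarrow> complex mat" where
  "circ_bidiag n \<alpha> \<beta> = \<alpha> \<cdot>\<^sub>m 1\<^sub>m n + \<beta> \<cdot>\<^sub>m Pi_mat n"

lemma circ_bidiag_carrier: "circ_bidiag n \<alpha> \<beta> \<in> carrier_mat n n"
  by (simp add: circ_bidiag_def)

lemma dim_circ_bidiag [simp]:
  "dim_row (circ_bidiag n \<alpha> \<beta>) = n" "dim_col (circ_bidiag n \<alpha> \<beta>) = n"
  by (simp_all add: circ_bidiag_def)

lemma circ_bidiag_index:
  assumes "n \<ge> 2" "i < n" "j < n"
  shows "circ_bidiag n \<alpha> \<beta> $$ (i, j) =
    (if j = i then \<alpha> else 0) + (if j = (if Suc i = n then 0 else Suc i) then \<beta> else 0)"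
  using assms by (auto simp: circ_bidiag_def Pi_mat_index)

text \<open>The position of \<beta> is solved for the row index here, so that sums over the row
  index collapse by \<open>sum.delta\<close>.\<close>

lemma circ_bidiag_index':
  assumes "n \<ge> 2" "i < n" "j < n"
  shows "circ_bidiag n \<alpha> \<beta> $$ (i, j) =
    (if i = j then \<alpha> else 0) + (if i = (if j = 0 then n - 1 else j - 1) then \<beta> else 0)"
proof -
  have "j = (if Suc i = n then 0 else Suc i) \<longleftrightarrow> i = (if j = 0 then n - 1 else j - 1)"
    using assms by (cases "j = 0"; cases "Suc i = n") auto
  then show ?thesis using assms by (simp only: circ_bidiag_index eq_commute[of j i])
qed

lemma circ_bidiag_mult_vec:
  assumes "n \<ge> 2" "i < n" "u \<in> carrier_vec n"
  shows "(circ_bidiag n \<alpha> \<beta> *\<^sub>v u) $ i = \<alpha> * u $ i + \<beta> * u $ (if Suc i = n then 0 else Suc i)"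
proof -
  have "(circ_bidiag n \<alpha> \<beta> *\<^sub>v u) $ i = (\<Sum>j<n. circ_bidiag n \<alpha> \<beta> $$ (i, j) * u $ j)"
    using assms by (auto simp: scalar_prod_def atLeast0LessThan intro!: sum.cong)
  also have "\<dots> = (\<Sum>j<n. (if j = i then \<alpha> * u $ j else 0)
      + (if j = (if Suc i = n then 0 else Suc i) then \<beta> * u $ j else 0))"
    using assms by (intro sum.cong refl) (auto simp: circ_bidiag_index)
  also have "\<dots> = \<alpha> * u $ i + \<beta> * u $ (if Suc i = n then 0 else Suc i)"
    using assms unfolding sum.distrib by (subst (1 2) sum.delta) auto
  finally show ?thesis .
qed

text \<open>Left multiplication by \<Pi> moves row i + 1 into row i, and in a circulant that row is
  the right shift of row i. The first row is therefore shifted right, whence the index d -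
  1.\<close>

lemma circ_bidiag_mult_circ:
  assumes "n \<ge> 2" "dim_vec c = n"
  shows "circ_bidiag n \<alpha> \<beta> * circ c =
    circ (vec n (\<lambda>d. \<alpha> * c $ d + \<beta> * c $ (if d = 0 then n - 1 else d - 1)))" (is "?l = ?r")
proof (rule eq_matI)
  fix i j assume "i < dim_row ?r" "j < dim_col ?r"
  then have ij: "i < n" "j < n" by simp_all
  let ?i = "if Suc i = n then 0 else Suc i"
  let ?d = "if i \<le> j then j - i else j + n - i"
  have col: "col (circ c) j $ k = c $ (if k \<le> j then j - k else j + n - k)" if "k < n" for k
    using that ij assms by (simp add: circ_index_diff)
  have i: "?i < n" and d: "?d < n" using ij assms by auto
  have "?l $$ (i, j) = (circ_bidiag n \<alpha> \<beta> *\<^sub>v col (circ c) j) $ i"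
    using ij assms by auto
  also have "\<dots> = \<alpha> * col (circ c) j $ i + \<beta> * col (circ c) j $ ?i"
    by (rule circ_bidiag_mult_vec[OF assms(1) ij(1)]) (simp add: carrier_vecI assms(2))
  also have "\<dots> = \<alpha> * c $ ?d + \<beta> * c $ (if ?d = 0 then n - 1 else ?d - 1)"
  proof -
    \<comment> \<open>Going down one row, cyclically, lowers the cyclic offset between row and
      column by one.\<close>
    have e: "(if ?i \<le> j then j - ?i else j + n - ?i) = (if ?d = 0 then n - 1 else ?d - 1)"
    proof (cases "Suc i = n")
      case True
      then show ?thesis using ij by (cases "i = j") auto
    next
      case False
      consider "i < j" | "i = j" | "j < i" by linarith
      then show ?thesis using False ij by cases auto
    qed
    show ?thesis unfolding col[OF ij(1)] col[OF i] e ..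
  qed
  also have "\<dots> = ?r $$ (i, j)"
    using ij by (simp only: circ_index_diff dim_vec index_vec[OF d])
  finally show "?l $$ (i, j) = ?r $$ (i, j)" .
qed (use assms in auto)

text \<open>The right-hand side is that of \<open>circ_bidiag_mult_circ\<close>, so the two factors
  commute. Here column j of the product combines columns j and j - 1, and going left one column also
  lowers the offset by one.\<close>

lemma circ_mult_circ_bidiag:
  assumes "n \<ge> 2" "dim_vec c = n"
  shows "circ c * circ_bidiag n \<alpha> \<beta> =
    circ (vec n (\<lambda>d. \<alpha> * c $ d + \<beta> * c $ (if d = 0 then n - 1 else d - 1)))" (is "?l = ?r")
proof (rule eq_matI)
  fix i j assume "i < dim_row ?r" "j < dim_col ?r"
  then have ij: "i < n" "j < n" by simp_all
  let ?j = "if j = 0 then n - 1 else j - 1"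
  let ?d = "if i \<le> j then j - i else j + n - i"
  have "?l $$ (i, j) = (\<Sum>k<n. circ c $$ (i, k) * circ_bidiag n \<alpha> \<beta> $$ (k, j))"
    using assms ij by (subst mat_mult_index_sum) auto
  also have "\<dots> = (\<Sum>k<n. (if k = j then \<alpha> * circ c $$ (i, k) else 0)
      + (if k = ?j then \<beta> * circ c $$ (i, k) else 0))"
    using assms ij by (intro sum.cong refl) (auto simp: circ_bidiag_index')
  also have "\<dots> = \<alpha> * circ c $$ (i, j) + \<beta> * circ c $$ (i, ?j)"
    using assms ij unfolding sum.distrib by (subst (1 2) sum.delta) auto
  also have "\<dots> = ?r $$ (i, j)"
  proof -
    have "(if i \<le> ?j then ?j - i else ?j + n - i) = (if ?d = 0 then n - 1 else ?d - 1)"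
    proof (cases "j = 0")
      case True
      then show ?thesis using ij by (cases "i = 0"; cases "i = n - 1") auto
    next
      case False
      consider "i < j" | "i = j" | "j < i" by linarith
      then show ?thesis using False ij by cases auto
    qed
    moreover have "?j < n" "?d < n" using ij by auto
    ultimately show ?thesis
      using ij by (simp only: circ_index_diff assms dim_vec index_vec)
  qed
  finally show "?l $$ (i, j) = ?r $$ (i, j)" .
qed (use assms in auto)

section \<open>Null space and singularity\<close>

text \<open>Each row of the system gives the next component as -\<alpha>/\<beta> times the present
  one. The closing condition keeps the factor \<open>u $ 0\<close> so that the zero vector is
  covered for every ratio.\<close>

lemma circ_bidiag_mult_vec_eq_0_iff:
  assumes n: "n \<ge> 2" and \<beta>: "\<beta> \<noteq> 0" and u: "u \<in> carrier_vec n"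
  shows "circ_bidiag n \<alpha> \<beta> *\<^sub>v u = 0\<^sub>v n \<longleftrightarrow>
    u = u $ 0 \<cdot>\<^sub>v vec n (\<lambda>i. (- \<alpha> / \<beta>) ^ i) \<and> u $ 0 * (- \<alpha> / \<beta>) ^ n = u $ 0"
    (is "?l \<longleftrightarrow> ?r")
proof -
  define r where "r = - \<alpha> / \<beta>"
  have "?l \<longleftrightarrow> (\<forall>i<n. \<alpha> * u $ i + \<beta> * u $ (if Suc i = n then 0 else Suc i) = 0)"
    using n u
    by (subst vec_eq_iff) (auto simp: circ_bidiag_mult_vec simp del: index_mult_mat_vec)
  also have "\<dots> \<longleftrightarrow> (\<forall>i<n. u $ (if Suc i = n then 0 else Suc i) = r * u $ i)"
  proof -
    have "\<alpha> * x + \<beta> * y = 0 \<longleftrightarrow> y = r * x" for x y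
      unfolding r_def using \<beta> by (auto simp: field_simps add_eq_0_iff)
    then show ?thesis by simp
  qed
  also have "\<dots> \<longleftrightarrow> (\<forall>i<n. u $ i = u $ 0 * r ^ i) \<and> u $ 0 * r ^ n = u $ 0" (is "?A \<longleftrightarrow> ?B")
  proof
    assume A: ?A
    have P: "u $ i = u $ 0 * r ^ i" if "i < n" for i
      using that
    proof (induction i)
      case (Suc i)
      then show ?case using A[rule_format, of i] by simp
    qed simp
    \<comment> \<open>This is the last row, where the successor of position n - 1 is position
      0.\<close>
    moreover have "u $ 0 * r ^ n = u $ 0"
    proof -
      have "u $ 0 * r ^ n = r * (u $ 0 * r ^ (n - 1))"
        using n by (cases n) auto
      also have "u $ 0 * r ^ (n - 1) = u $ (n - 1)"
        using P[of "n - 1"] n by simp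
      also have "r * \<dots> = u $ 0"
        using A[rule_format, of "n - 1"] n by simp
      finally show ?thesis .
    qed
    ultimately show ?B by blast
  next
    assume "?B"
    then have B: "u $ i = u $ 0 * r ^ i" if "i < n" for i
      using that by blast
    from \<open>?B\<close> have rn: "u $ 0 * r ^ n = u $ 0" ..
    show ?A
    proof (intro allI impI)
      fix i assume i: "i < n"
      have "u $ (if Suc i = n then 0 else Suc i) = u $ 0 * r ^ Suc i"
      proof (cases "Suc i = n")
        case True
        show ?thesis unfolding if_P[OF True] using rn[folded True] by (rule sym)
      next
        case False
        show ?thesis unfolding if_not_P[OF False] using False i by (intro B) simp
      qed
      also have "\<dots> = r * (u $ 0 * r ^ i)" by simp
      also have "u $ 0 * r ^ i = u $ i" by (rule B[OF i, symmetric])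
      finally show "u $ (if Suc i = n then 0 else Suc i) = r * u $ i" .
    qed
  qed
  also have "\<dots> \<longleftrightarrow> ?r"
  proof -
    have "(\<forall>i<n. u $ i = u $ 0 * r ^ i) \<longleftrightarrow> u = u $ 0 \<cdot>\<^sub>v vec n (\<lambda>i. r ^ i)" (is "_ \<longleftrightarrow> u = ?v")
    proof
      assume v: "u = ?v"
      show "\<forall>i<n. u $ i = u $ 0 * r ^ i"
      proof (intro allI impI)
        fix i assume i: "i < n"
        \<comment> \<open>The right side of \<open>v\<close> contains u itself, so it would loop as
          a rewrite rule; it is applied just once.\<close>
        have "u $ i = ?v $ i" using v by (rule arg_cong)
        also have "\<dots> = u $ 0 * r ^ i" using i by simp
        finally show "u $ i = u $ 0 * r ^ i" .
      qed
    next
      assume *: "\<forall>i<n. u $ i = u $ 0 * r ^ i"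
      show "u = ?v"
      proof (rule eq_vecI)
        fix i assume "i < dim_vec ?v"
        then have i: "i < n" by simp
        then have "?v $ i = u $ 0 * r ^ i" by simp
        then show "u $ i = ?v $ i" using * i by metis
      qed (use u in auto)
    qed
    then show ?thesis unfolding r_def by simp
  qed
  finally show ?thesis .
qed

text \<open>The closing condition is now automatic, and since the geometric vector starts with 1,
  \<open>u $ 0\<close> is the coefficient of u in the span.\<close>

lemma mat_kernel_circ_bidiag:
  assumes n: "n \<ge> 2" and \<beta>: "\<beta> \<noteq> 0" and r: "(- \<alpha> / \<beta>) ^ n = 1"
  shows "mat_kernel (circ_bidiag n \<alpha> \<beta>) = vec_span n {vec n (\<lambda>i. (- \<alpha> / \<beta>) ^ i)}"
proof -
  let ?v = "vec n (\<lambda>i. (- \<alpha> / \<beta>) ^ i)"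
  have "mat_kernel (circ_bidiag n \<alpha> \<beta>) = {u \<in> carrier_vec n. u = u $ 0 \<cdot>\<^sub>v ?v}"
    using n \<beta> r by (auto simp: mat_kernel[OF circ_bidiag_carrier] circ_bidiag_mult_vec_eq_0_iff)
  also have "\<dots> = {a \<cdot>\<^sub>v ?v | a. True}"
    using n by auto
  finally show ?thesis by (simp add: vec_span_singleton)
qed

text \<open>A nonzero null vector has a nonzero first component, since it is geometric, and
  cancelling this component leaves (-\<alpha>/\<beta>)^n = 1. Conversely the geometric vector itself
  is a null vector.\<close>

lemma invertible_circ_bidiag_iff:
  assumes n: "n \<ge> 2" and \<beta>: "\<beta> \<noteq> 0"
  shows "invertible_mat (circ_bidiag n \<alpha> \<beta>) \<longleftrightarrow> \<beta> ^ n \<noteq> (- 1) ^ n * \<alpha> ^ n"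
proof -
  let ?v = "vec n (\<lambda>i. (- \<alpha> / \<beta>) ^ i)"
  have "\<not> invertible_mat (circ_bidiag n \<alpha> \<beta>) \<longleftrightarrow>
      (\<exists>u. u \<in> carrier_vec n \<and> u \<noteq> 0\<^sub>v n \<and> circ_bidiag n \<alpha> \<beta> *\<^sub>v u = 0\<^sub>v n)"
    by (simp add: invertible_mat_iff_det[OF circ_bidiag_carrier]
        det_0_iff_vec_prod_zero_field[OF circ_bidiag_carrier])
  also have "\<dots> \<longleftrightarrow> (- \<alpha> / \<beta>) ^ n = 1"
  proof
    assume "\<exists>u. u \<in> carrier_vec n \<and> u \<noteq> 0\<^sub>v n \<and> circ_bidiag n \<alpha> \<beta> *\<^sub>v u = 0\<^sub>v n"
    then obtain u where u: "u \<in> carrier_vec n" "u \<noteq> 0\<^sub>v n"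
      and e: "u = u $ 0 \<cdot>\<^sub>v ?v" "u $ 0 * (- \<alpha> / \<beta>) ^ n = u $ 0"
      using circ_bidiag_mult_vec_eq_0_iff[OF n \<beta>] by blast
    have "u $ 0 \<noteq> 0"
    proof
      assume "u $ 0 = 0"
      then have "u = 0\<^sub>v n" by (subst e(1)) (auto intro!: eq_vecI)
      with u(2) show False ..
    qed
    then show "(- \<alpha> / \<beta>) ^ n = 1" using e(2) by simp
  next
    assume r: "(- \<alpha> / \<beta>) ^ n = 1"
    have "?v $ 0 = 1" "?v \<noteq> 0\<^sub>v n"
      using n by (auto simp: vec_eq_iff intro!: exI[of _ 0])
    moreover from this r have "circ_bidiag n \<alpha> \<beta> *\<^sub>v ?v = 0\<^sub>v n"
      using circ_bidiag_mult_vec_eq_0_iff[OF n \<beta>, of ?v \<alpha>] by simp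
    ultimately show "\<exists>u. u \<in> carrier_vec n \<and> u \<noteq> 0\<^sub>v n \<and> circ_bidiag n \<alpha> \<beta> *\<^sub>v u = 0\<^sub>v n"
      by (intro exI[of _ ?v]) auto
  qed
  also have "\<dots> \<longleftrightarrow> \<beta> ^ n = (- 1) ^ n * \<alpha> ^ n"
    unfolding power_divide power_minus[of \<alpha>] using \<beta> by (auto simp: divide_eq_1_iff)
  finally show ?thesis by blast
qed

section \<open>The Moore-Penrose inverse for ratio 1 or -1\<close>

text \<open>Both parts of the theorem are the case \<open>\<beta> = - s \<alpha>\<close> with \<open>s\<^sup>2 = s\<^sup>n = 1\<close>. Telescoping the first row
  of \<open>X\<close> gives \<open>C X = X C = I - v v\<^sup>t / n\<close> for the null vector \<open>v = (s\<^sup>i)\<close>, which is Hermitian. Then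
  \<open>C v = 0\<close> yields \<open>C X C = C\<close>. Since \<open>X v\<close> lies in the kernel of \<open>C\<close> as well, it is a multiple of \<open>v\<close>
  and its component at \<open>0\<close> decides that it vanishes, whence \<open>X C X = X\<close>.\<close>

lemma is_moore_penrose_circ_bidiag:
  assumes n: "n \<ge> 2" and \<alpha>: "\<alpha> \<noteq> 0" and s: "s = 1 \<or> s = - 1" and sn: "s ^ n = 1"
  shows "is_moore_penrose (circ_bidiag n \<alpha> (- s * \<alpha>))
    (circ (vec n (\<lambda>d. s ^ d * (of_nat n - 1 - 2 * of_nat d) / (2 * of_nat n * \<alpha>))))"
proof -
  define x where "x = vec n (\<lambda>d. s ^ d * (of_nat n - 1 - 2 * of_nat d) / (2 * of_nat n * \<alpha>))"
  define C where "C = circ_bidiag n \<alpha> (- s * \<alpha>)"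
  define X where "X = circ x"
  define v where "v = vec n (\<lambda>i. s ^ i)"
  define P where "P = mat n n (\<lambda>(i, j). (if i = j then 1 else 0) - s ^ i * s ^ j / of_nat n)"
  have ss: "s * s = 1" "s \<noteq> 0" "cnj s = s" using s by auto
  then have inv: "1 / s = s" by (simp add: field_simps)
  have cC: "C \<in> carrier_mat n n" unfolding C_def by (rule circ_bidiag_carrier)
  have cx: "dim_vec x = n" and cX: "X \<in> carrier_mat n n" and cv: "v \<in> carrier_vec n"
    and cP: "P \<in> carrier_mat n n"
    using circ_carrier[of x] by (auto simp: x_def X_def v_def P_def)
  \<comment> \<open>Exponents of s count only modulo 2, and s^n = 1 absorbs the wrap-around, so the
    circulant generated by (s^d) is v v^t.\<close>
  have p: "s ^ (if i \<le> j then j - i else j + n - i) = s ^ i * s ^ j" if "i < n" for i j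
  proof -
    have "s ^ i * s ^ i = 1" using ss by (metis power_mult_distrib power_one)
    moreover have "s ^ i * s ^ (if i \<le> j then j - i else j + n - i) = s ^ j"
      using that sn by (auto simp flip: power_add) (auto simp: power_add)
    ultimately show ?thesis by (metis mult.assoc mult_1)
  qed
  define y where
    "y = vec n (\<lambda>d. \<alpha> * x $ d + (- s * \<alpha>) * x $ (if d = 0 then n - 1 else d - 1))"
  have P: "circ y = P"
  proof (rule eq_matI)
    fix i j assume "i < dim_row P" "j < dim_col P"
    then have ij: "i < n" "j < n" using cP by auto
    \<comment> \<open>The progression n - 1 - 2d falls by 2 at each step, giving -s^d/n. At d = 0
      the predecessor is the last term, 1 - n, and s * s^(n-1) = 1, so the two ends add up to 1 -
      1/n.\<close>
    have y: "y $ d = (if d = 0 then 1 else 0) - s ^ d / of_nat n" if d: "d < n" for d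
    proof (cases "d = 0")
      case True
      have "s * s ^ (n - 1) = 1" using n sn by (simp flip: power_Suc)
      then show ?thesis
        using True n \<alpha> by (simp add: y_def x_def of_nat_diff field_simps)
    next
      case False
      then obtain e where e: "d = Suc e" by (cases d) auto
      then show ?thesis
        using d n \<alpha> by (simp add: y_def x_def field_simps)
    qed
    have "circ y $$ (i, j) = y $ (if i \<le> j then j - i else j + n - i)"
      using ij by (simp add: circ_index_diff y_def del: index_vec)
    also have "\<dots> = (if i = j then 1 else 0) - s ^ (if i \<le> j then j - i else j + n - i) / of_nat n"
      using ij by (subst y) auto
    finally show "circ y $$ (i, j) = P $$ (i, j)"
      using ij unfolding p[OF ij(1)] by (simp add: P_def)
  qed (use cP in \<open>auto simp: y_def\<close>)
  have CX: "C * X = P" and XC: "X * C = P"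
    using circ_bidiag_mult_circ[OF n cx] circ_mult_circ_bidiag[OF n cx] P
    by (simp_all add: C_def X_def y_def)
  have r: "- \<alpha> / (- s * \<alpha>) = s" using \<alpha> ss inv by simp
  have ker: "C *\<^sub>v u = 0\<^sub>v n \<longleftrightarrow> u = u $ 0 \<cdot>\<^sub>v v" if "u \<in> carrier_vec n" for u
    using circ_bidiag_mult_vec_eq_0_iff[OF n _ that, of "- s * \<alpha>" \<alpha>] \<alpha> ss(2) sn
    unfolding r C_def v_def by simp
  have Cv: "C *\<^sub>v v = 0\<^sub>v n"
    using ker[OF cv] n by (auto simp: v_def)
  have Xv: "X *\<^sub>v v = 0\<^sub>v n"
  proof -
    have "C *\<^sub>v (X *\<^sub>v v) = X *\<^sub>v (C *\<^sub>v v)"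
      using CX XC assoc_mult_mat_vec[OF cC cX cv] assoc_mult_mat_vec[OF cX cC cv] by simp
    also have "\<dots> = 0\<^sub>v n"
      unfolding Cv using cX by (intro eq_vecI) auto
    finally have 1: "X *\<^sub>v v = (X *\<^sub>v v) $ 0 \<cdot>\<^sub>v v"
      using ker cX cv by auto
    have "(X *\<^sub>v v) $ 0 = (\<Sum>j<n. x $ j * s ^ j)"
      using n cX cx
      by (auto simp: scalar_prod_def atLeast0LessThan v_def X_def circ_index_diff intro!: sum.cong)
    also have "\<dots> = (\<Sum>j<n. (of_nat n - 1 - 2 * of_nat j) / (2 * of_nat n * \<alpha>))"
    proof (rule sum.cong)
      fix j assume "j \<in> {..<n}"
      moreover have "s ^ j * s ^ j = 1" using ss by (metis power_mult_distrib power_one)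
      ultimately show "x $ j * s ^ j = (of_nat n - 1 - 2 * of_nat j) / (2 * of_nat n * \<alpha>)"
        by (simp add: x_def mult.commute mult.left_commute)
    qed simp
    also have "\<dots> = (\<Sum>j<n. of_nat n - 1 - 2 * of_nat j) / (2 * of_nat n * \<alpha>)"
      by (simp add: sum_divide_distrib)
    \<comment> \<open>The range m is separated from the n in the summand so that induction applies;
      the sum vanishes at m = n.\<close>
    also have "(\<Sum>j<m. of_nat n - 1 - 2 * of_nat j) = of_nat m * (of_nat n - of_nat m :: complex)" for m
      by (induction m) (auto simp: algebra_simps)
    finally have "(X *\<^sub>v v) $ 0 = 0" by simp
    then have "X *\<^sub>v v = 0 \<cdot>\<^sub>v v" using 1 by (simp only:)
    then show ?thesis using cv by auto
  qed
  \<comment> \<open>A P = A - (A v) v^t / n, so P is a right identity for matrices that kill v. It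
    serves for both C and X.\<close>
  have AP: "A * P = A" if A: "A \<in> carrier_mat n n" and Av: "A *\<^sub>v v = 0\<^sub>v n" for A
  proof (rule eq_matI)
    fix i j assume "i < dim_row A" "j < dim_col A"
    then have ij: "i < n" "j < n" using A by auto
    have "(\<Sum>k<n. A $$ (i, k) * s ^ k) = (A *\<^sub>v v) $ i"
      using ij A by (auto simp: scalar_prod_def atLeast0LessThan v_def intro!: sum.cong)
    then have 0: "(\<Sum>k<n. A $$ (i, k) * s ^ k) = 0" using Av ij by simp
    have "(A * P) $$ (i, j) = (\<Sum>k<n. A $$ (i, k) * P $$ (k, j))"
      using A cP ij by (subst mat_mult_index_sum) auto
    also have "\<dots> = (\<Sum>k<n. (if k = j then A $$ (i, k) else 0)
        - A $$ (i, k) * s ^ k * (s ^ j / of_nat n))"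
      using ij by (intro sum.cong refl) (auto simp: P_def algebra_simps)
    also have "\<dots> = A $$ (i, j)"
      unfolding sum_subtractf sum_distrib_right[symmetric] 0 using ij by simp
    finally show "(A * P) $$ (i, j) = A $$ (i, j)" .
  qed (use that cP in auto)
  have "mat_adjoint P = P"
    using cP by (intro eq_matI) (auto simp: mat_adjoint_index P_def ss mult.commute)
  moreover have "C * X * C = C"
    using AP[OF cC Cv] XC assoc_mult_mat[OF cC cX cC] by simp
  moreover have "X * C * X = X"
    using AP[OF cX Xv] CX assoc_mult_mat[OF cX cC cX] by simp
  ultimately have "is_moore_penrose C X"
    using cC cX unfolding is_moore_penrose_def CX XC by auto
  then show ?thesis
    unfolding C_def X_def x_def .
qed

section \<open>Closed forms of the inverse\<close>

text \<open>Half of the summand 2 in w cancels the subtracted alternating circulant. What remains at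
  offset d = k - 1 is (-1)^d n (n - 1 - 2d) / 2, and one factor n cancels.\<close>

lemma circ_alternating_ramp:
  fixes \<alpha> :: complex
  assumes n: "n \<ge> 2" and \<alpha>: "\<alpha> \<noteq> 0"
    and w: "w = vec1 n (\<lambda>k. (-1) ^ (k + 1) * (real n ^ 2 - (2 * real k - 1) * real n + 2))"
  shows "circ (vec n (\<lambda>d. (- 1) ^ d * (of_nat n - 1 - 2 * of_nat d) / (2 * of_nat n * \<alpha>))) =
    (1 / (\<alpha> * of_nat n ^ 2)) \<cdot>\<^sub>m
      ((1 / 2) \<cdot>\<^sub>m circ (map_vec complex_of_real w) - circ (vec1 n (\<lambda>k. (-1) ^ (k + 1))))"
    (is "circ ?x = ?r")
proof (rule eq_matI)
  fix i j assume "i < dim_row ?r" "j < dim_col ?r"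
  then have ij: "i < n" "j < n" by (simp_all add: vec1_def)
  define d where "d = (if i \<le> j then j - i else j + n - i)"
  have d: "d < n" using ij by (auto simp: d_def)
  have entry: "circ c $$ (i, j) = c $ d" if "dim_vec c = n" for c :: "complex vec"
    using that ij by (simp add: circ_index_diff d_def)
  have "?r $$ (i, j) = (1 / (\<alpha> * of_nat n ^ 2)) * (1 / 2 *
      ((- 1) ^ d * (of_nat n ^ 2 - (2 * of_nat (d + 1) - 1) * of_nat n + 2)) - (- 1) ^ d)"
    using ij d by (simp add: entry w vec1_def)
  also have "\<dots> = (- 1) ^ d * (of_nat n - 1 - 2 * of_nat d) / (2 * of_nat n * \<alpha>)"
    using n \<alpha> by (simp add: field_simps power2_eq_square)
  also have "\<dots> = circ ?x $$ (i, j)" using d by (simp add: entry)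
  finally show "circ ?x $$ (i, j) = ?r $$ (i, j)" ..
qed (simp_all add: vec1_def)

lemma circ_ramp:
  fixes \<alpha> :: complex
  assumes "n \<ge> 2" and "\<alpha> \<noteq> 0"
  shows "circ (vec n (\<lambda>d. (of_nat n - 1 - 2 * of_nat d) / (2 * of_nat n * \<alpha>))) =
    (1 / (2 * of_nat n * \<alpha>)) \<cdot>\<^sub>m circ (vec1 n (\<lambda>k. of_nat n + 1 - 2 * of_nat k))"
  using assms by (intro eq_matI) (auto simp: vec1_def circ_index_diff field_simps)

text \<open>All entries of e e^t are 1, and 1 - (2k - 1)/n = (n + 1 - 2k)/n.\<close>

lemma circ_odd_numbers_ones:
  fixes \<alpha> :: complex
  assumes "n \<ge> 2" and "\<alpha> \<noteq> 0"
  shows "(1 / (2 * \<alpha>)) \<cdot>\<^sub>m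
      ((- 1 / of_nat n) \<cdot>\<^sub>m circ (vec1 n (\<lambda>k. 2 * of_nat k - 1))
        + col_mat (ones_vec n) * transpose_mat (col_mat (ones_vec n))) =
    (1 / (2 * of_nat n * \<alpha>)) \<cdot>\<^sub>m circ (vec1 n (\<lambda>k. of_nat n + 1 - 2 * of_nat k))"
  using assms
  by (intro eq_matI)
    (auto simp: vec1_def circ_index_diff col_mat_def ones_vec_def scalar_prod_def
      mat_of_cols_index field_simps)

text \<open>The case s = -1: evenness of n is what s^n = 1 demands. With k = i + 1 the sign
  (-1)^(k+1) is (-1)^i, the geometric null vector.\<close>

lemma circ_bidiag_same:
  assumes n: "n \<ge> 2" "even n" and \<alpha>: "\<alpha> \<noteq> 0"
    and w: "w = vec1 n (\<lambda>k. (-1) ^ (k + 1) * (real n ^ 2 - (2 * real k - 1) * real n + 2))"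
  shows "mat_kernel (circ_bidiag n \<alpha> \<alpha>) = vec_span n {vec1 n (\<lambda>k. (-1) ^ (k + 1))}"
    and "moore_penrose (circ_bidiag n \<alpha> \<alpha>) = (1 / (\<alpha> * of_nat n ^ 2)) \<cdot>\<^sub>m
      ((1 / 2) \<cdot>\<^sub>m circ (map_vec complex_of_real w) - circ (vec1 n (\<lambda>k. (-1) ^ (k + 1))))"
proof -
  show "mat_kernel (circ_bidiag n \<alpha> \<alpha>) = vec_span n {vec1 n (\<lambda>k. (-1) ^ (k + 1))}"
    using mat_kernel_circ_bidiag[of n \<alpha> \<alpha>] n \<alpha> by (simp add: vec1_def)
  have "is_moore_penrose (circ_bidiag n \<alpha> \<alpha>)
      (circ (vec n (\<lambda>d. (- 1) ^ d * (of_nat n - 1 - 2 * of_nat d) / (2 * of_nat n * \<alpha>))))"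
    using is_moore_penrose_circ_bidiag[of n \<alpha> "- 1"] n \<alpha> by simp
  then show "moore_penrose (circ_bidiag n \<alpha> \<alpha>) = (1 / (\<alpha> * of_nat n ^ 2)) \<cdot>\<^sub>m
      ((1 / 2) \<cdot>\<^sub>m circ (map_vec complex_of_real w) - circ (vec1 n (\<lambda>k. (-1) ^ (k + 1))))"
    unfolding circ_alternating_ramp[OF n(1) \<alpha> w] by (rule moore_penrose_eqI)
qed

text \<open>The case s = 1, where s^n = 1 holds for every n and the geometric null vector is
  constant.\<close>

lemma circ_bidiag_opposite:
  assumes n: "n \<ge> 2" and \<alpha>: "\<alpha> \<noteq> 0"
  shows "mat_kernel (circ_bidiag n \<alpha> (- \<alpha>)) = vec_span n {ones_vec n}"
    and "moore_penrose (circ_bidiag n \<alpha> (- \<alpha>)) =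
      (1 / (2 * of_nat n * \<alpha>)) \<cdot>\<^sub>m circ (vec1 n (\<lambda>k. of_nat n + 1 - 2 * of_nat k))"
proof -
  show "mat_kernel (circ_bidiag n \<alpha> (- \<alpha>)) = vec_span n {ones_vec n}"
    using mat_kernel_circ_bidiag[of n "- \<alpha>" \<alpha>] n \<alpha> by (simp add: ones_vec_def)
  have "is_moore_penrose (circ_bidiag n \<alpha> (- \<alpha>))
      (circ (vec n (\<lambda>d. (of_nat n - 1 - 2 * of_nat d) / (2 * of_nat n * \<alpha>))))"
    using is_moore_penrose_circ_bidiag[of n \<alpha> 1] n \<alpha> by simp
  then show "moore_penrose (circ_bidiag n \<alpha> (- \<alpha>)) =
      (1 / (2 * of_nat n * \<alpha>)) \<cdot>\<^sub>m circ (vec1 n (\<lambda>k. of_nat n + 1 - 2 * of_nat k))"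
    unfolding circ_ramp[OF n \<alpha>] by (rule moore_penrose_eqI)
qed

theorem proposition4p3:
  fixes n :: nat and \<alpha> \<beta> :: complex and C :: "complex mat" and w :: "real vec"
  assumes "n \<ge> 2" and "\<alpha> \<noteq> 0" and "\<beta> \<noteq> 0"
    and C: "C = \<alpha> \<cdot>\<^sub>m 1\<^sub>m n + \<beta> \<cdot>\<^sub>m Pi_mat n"
    and w: "w = vec1 n (\<lambda>k. (-1) ^ (k + 1) * (real n ^ 2 - (2 * real k - 1) * real n + 2))"
  shows "(\<not> invertible_mat C \<longleftrightarrow> \<beta> ^ n = (-1) ^ n * \<alpha> ^ n) \<and>
    (even n \<and> \<alpha> = \<beta> \<longrightarrow>
      mat_kernel C = vec_span n {vec1 n (\<lambda>k. (-1) ^ (k + 1))} \<and>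
      moore_penrose C = (1 / (\<alpha> * of_nat n ^ 2)) \<cdot>\<^sub>m
        ((1 / 2) \<cdot>\<^sub>m circ (map_vec complex_of_real w) - circ (vec1 n (\<lambda>k. (-1) ^ (k + 1))))) \<and>
    (\<alpha> = - \<beta> \<longrightarrow>
      mat_kernel C = vec_span n {ones_vec n} \<and>
      moore_penrose C = (1 / (2 * \<alpha>)) \<cdot>\<^sub>m
        ((- 1 / of_nat n) \<cdot>\<^sub>m circ (vec1 n (\<lambda>k. 2 * of_nat k - 1))
          + col_mat (ones_vec n) * transpose_mat (col_mat (ones_vec n))) \<and>
      (1 / (2 * \<alpha>)) \<cdot>\<^sub>m
        ((- 1 / of_nat n) \<cdot>\<^sub>m circ (vec1 n (\<lambda>k. 2 * of_nat k - 1))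
          + col_mat (ones_vec n) * transpose_mat (col_mat (ones_vec n)))
        = (1 / (2 * of_nat n * \<alpha>)) \<cdot>\<^sub>m circ (vec1 n (\<lambda>k. of_nat n + 1 - 2 * of_nat k)))"
proof (intro conjI impI)
  show "\<not> invertible_mat C \<longleftrightarrow> \<beta> ^ n = (-1) ^ n * \<alpha> ^ n"
    using invertible_circ_bidiag_iff[OF assms(1,3), of \<alpha>]
    unfolding C circ_bidiag_def[symmetric] by blast
next
  assume *: "even n \<and> \<alpha> = \<beta>"
  then have "even n" and C_eq: "C = circ_bidiag n \<alpha> \<alpha>" by (simp_all only: C circ_bidiag_def)
  note same = circ_bidiag_same[OF assms(1) \<open>even n\<close> assms(2) w]
  show "mat_kernel C = vec_span n {vec1 n (\<lambda>k. (-1) ^ (k + 1))}"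
    unfolding C_eq by (rule same(1))
  show "moore_penrose C = (1 / (\<alpha> * of_nat n ^ 2)) \<cdot>\<^sub>m
      ((1 / 2) \<cdot>\<^sub>m circ (map_vec complex_of_real w) - circ (vec1 n (\<lambda>k. (-1) ^ (k + 1))))"
    unfolding C_eq by (rule same(2))
next
  assume "\<alpha> = - \<beta>"
  then have "\<beta> = - \<alpha>" by simp
  then have C_eq: "C = circ_bidiag n \<alpha> (- \<alpha>)" by (simp only: C circ_bidiag_def)
  note opposite = circ_bidiag_opposite[OF assms(1,2)] and forms = circ_odd_numbers_ones[OF assms(1,2)]
  show "mat_kernel C = vec_span n {ones_vec n}"
    unfolding C_eq by (rule opposite(1))
  show "moore_penrose C = (1 / (2 * \<alpha>)) \<cdot>\<^sub>m
      ((- 1 / of_nat n) \<cdot>\<^sub>m circ (vec1 n (\<lambda>k. 2 * of_nat k - 1))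
        + col_mat (ones_vec n) * transpose_mat (col_mat (ones_vec n)))"
    \<comment> \<open>\<open>forms\<close> turns the expression in odd numbers and e e^t into the
      single circulant for which the inverse is known.\<close>
    unfolding C_eq forms by (rule opposite(2))
  show "(1 / (2 * \<alpha>)) \<cdot>\<^sub>m
      ((- 1 / of_nat n) \<cdot>\<^sub>m circ (vec1 n (\<lambda>k. 2 * of_nat k - 1))
        + col_mat (ones_vec n) * transpose_mat (col_mat (ones_vec n)))
      = (1 / (2 * of_nat n * \<alpha>)) \<cdot>\<^sub>m circ (vec1 n (\<lambda>k. of_nat n + 1 - 2 * of_nat k))"
    by (rule forms)
qed

end
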